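(* Let $P\subset\mathbb R^2$ be a convex lattice polygon with nonzero area $A(P)$, and let $l=\operatorname{ls}_\Delta(P)$. Then $A(P)\ge \frac12 l$. Equality holds exactly when $P$ is lattice-equivalent to one of: (a) $\operatorname{conv}\{(0,0),(l,0),(0,1)\}$ (for $l\ge1$); (b) $[0,1]^2$ (when $l=2$); (c) $\operatorname{conv}\{(0,0),(1,2),(2,1)\}$ (when $l=3$).
   Context: A lattice polygon is a convex polygon all of whose vertices lie in $\mathbb Z^2$. An affine unimodular transformation is $x\mapsto Ax+v$ with $A\in\mathbb Z^{2\times2}$, $\det A=\pm1$, $v\in\mathbb Z^2$; two sets are lattice-equivalent if one is the image of the other under such a map. With $\Delta=\operatorname{conv}\{(0,0),(1,0),(0,1)\}$, $\operatorname{ls}_\Delta(P)$ is the smallest $l\ge0$ such that $\varphi(P)\subseteq l\Delta$ for some affine unimodular $\varphi$. *)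

theory Defs
  imports "HOL-Analysis.Analysis"
begin

definition lattice_points :: "(real \<times> real) set" where
  "lattice_points = {(x, y). x \<in> \<int> \<and> y \<in> \<int>}"

definition lattice_polygon :: "(real \<times> real) set \<Rightarrow> bool" where
  "lattice_polygon P \<longleftrightarrow>
     (\<exists>V. finite V \<and> V \<noteq> {} \<and> V \<subseteq> lattice_points \<and> P = convex hull V)"

definition aff_unimodular :: "(real \<times> real \<Rightarrow> real \<times> real) \<Rightarrow> bool" where
  "aff_unimodular \<phi> \<longleftrightarrow>
     (\<exists>a b c d e f :: int. (a * d - b * c = 1 \<or> a * d - b * c = -1) \<and>
        (\<forall>x y. \<phi> (x, y) = (of_int a * x + of_int b * y + of_int e,
                             of_int c * x + of_int d * y + of_int f)))"

definition lattice_equiv :: "(real \<times> real) set \<Rightarrow> (real \<times> real) set \<Rightarrow> bool" where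
  "lattice_equiv P Q \<longleftrightarrow> (\<exists>\<phi>. aff_unimodular \<phi> \<and> \<phi> ` P = Q)"

definition std_simplex :: "(real \<times> real) set" where
  "std_simplex = convex hull {(0, 0), (1, 0), (0, 1)}"

definition ls_Delta :: "(real \<times> real) set \<Rightarrow> real" where
  "ls_Delta P = Inf {l. l \<ge> 0 \<and> (\<exists>\<phi>. aff_unimodular \<phi> \<and> \<phi> ` P \<subseteq> (\<lambda>z. l *\<^sub>R z) ` std_simplex)}"

end

(* Idea: ls_Delta P <= k as soon as some unimodular image of the vertices lies in k times the
   standard simplex, so upper bounds for ls_Delta and lower bounds for the area suffice; equality
   then forces the three exceptional types.

   Choose coordinates in which the narrowest lattice strip containing P is 0 <= y <= w, and let
   (0, 0) and (t, w) with 0 <= t < w be vertices on its two sides. Let m and n be the largest values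
   of D = t y - w x and of -D on P. Two triangles over the segment from (0, 0) to (t, w) show
   2 A(P) >= m + n, whereas the half-planes x >= -(m div w), x - y <= n div w, y <= w cut out a
   triangle of size w + s with s = m div w + n div w. Minimality of w in the directions x and y - x
   gives s >= t and s >= w - t, and so w + s < w s <= m + n for w >= 3. For w = 1 the polygon is a
   trapezoid, and for w = 2 only s = 1, m + n <= 3 and s = 2, m + n = 4 remain. *)

theory Submission
  imports Defs
begin

section \<open>Area in the plane\<close>

text \<open>The determinant formula for measures of linear images and the area formula for triangles
  are stated on \<open>real ^ 2\<close>, whereas polygons are sets of pairs; this map carries areas
  across.\<close>

definition vec_of_pair :: "real \<times> real \<Rightarrow> real ^ 2" where
  "vec_of_pair z = (\<chi> i. if i = 1 then fst z else snd z)"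

definition pair_of_vec :: "real ^ 2 \<Rightarrow> real \<times> real" where
  "pair_of_vec v = (v $ 1, v $ 2)"

lemma vec_of_pair_nth [simp]: "vec_of_pair z $ 1 = fst z" "vec_of_pair z $ 2 = snd z"
  by (simp_all add: vec_of_pair_def)

lemma pair_of_vec_of_pair [simp]: "pair_of_vec (vec_of_pair z) = z"
  by (simp add: pair_of_vec_def)

lemma linear_vec_of_pair: "linear vec_of_pair"
  by (rule linearI) (simp_all add: vec_eq_iff forall_2)

lemma linear_pair_of_vec: "linear pair_of_vec"
  by (rule linearI) (simp_all add: pair_of_vec_def)

lemma continuous_on_vec_of_pair: "continuous_on S vec_of_pair"
  using linear_vec_of_pair by (simp add: linear_continuous_on linear_conv_bounded_linear)

text \<open>A Borel measure that gives every box the product of its side lengths is Lebesgue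
  measure, so comparing boxes is enough.\<close>

lemma lborel_vec_of_pair: "(lborel :: (real ^ 2) measure) = distr lborel borel vec_of_pair"
proof (rule lborel_eqI)
  fix l u :: "real ^ 2"
  assume le: "\<And>b. b \<in> Basis \<Longrightarrow> l \<bullet> b \<le> u \<bullet> b"
  have "l $ 1 \<le> u $ 1" "l $ 2 \<le> u $ 2"
    using le[of "axis 1 1"] le[of "axis 2 1"] by (auto simp: inner_axis)
  moreover have "vec_of_pair -` box l u = box (l $ 1, l $ 2) (u $ 1, u $ 2)"
    by (auto simp: box_def Basis_vec_def Basis_prod_def inner_axis forall_2)
  moreover have "(\<Prod>b\<in>Basis. (u - l) \<bullet> b) = (u $ 1 - l $ 1) * (u $ 2 - l $ 2)"
  proof -
    have "(Basis :: (real ^ 2) set) = {axis 1 1, axis 2 1}"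
      by (auto simp: Basis_vec_def UNIV_2)

    then have "(\<Prod>b\<in>Basis. (u - l) \<bullet> b) = (\<Prod>b\<in>{axis 1 1, axis 2 1}. (u - l) \<bullet> b)"
      by (rule arg_cong)
    then show ?thesis by (simp add: inner_axis axis_eq_axis)
  qed
  moreover have "vec_of_pair \<in> borel_measurable borel"
    by (intro borel_measurable_continuous_onI continuous_on_vec_of_pair)
  ultimately show "emeasure (distr lborel borel vec_of_pair) (box l u) = ennreal (\<Prod>b\<in>Basis. (u - l) \<bullet> b)"
    by (subst emeasure_distr)
       (auto simp: emeasure_lborel_box_eq Basis_prod_def ennreal_mult mult.commute)
qed simp

lemma measure_vec_of_pair:
  assumes "compact S"
  shows "measure lebesgue (vec_of_pair ` S) = measure lebesgue S"
proof -
  have c: "compact (vec_of_pair ` S)"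
    by (rule compact_continuous_image[OF continuous_on_vec_of_pair assms])
  have m: "vec_of_pair \<in> borel_measurable borel"
    by (intro borel_measurable_continuous_onI continuous_on_vec_of_pair)
  have v: "vec_of_pair -` vec_of_pair ` S = S"
    by (metis (no_types, lifting) inj_vimage_image_eq injI pair_of_vec_of_pair)
  have "measure lebesgue (vec_of_pair ` S) = measure lborel (vec_of_pair ` S)"
    using c by (simp add: borel_compact measure_completion)
  also have "\<dots> = measure (distr lborel borel vec_of_pair) (vec_of_pair ` S)"
    by (simp flip: lborel_vec_of_pair)
  also have "\<dots> = measure lborel S"
    using c m v by (subst measure_distr) (auto simp: borel_compact)
  also have "\<dots> = measure lebesgue S"
    using assms by (simp add: borel_compact measure_completion)
  finally show ?thesis .
qed

lemma measure_triangle_pair: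
  fixes a b c :: "real \<times> real"
  shows "measure lebesgue (convex hull {a, b, c}) =
    \<bar>(fst b - fst a) * (snd c - snd a) - (snd b - snd a) * (fst c - fst a)\<bar> / 2"
proof -
  have comp: "compact (convex hull {a, b, c})"
    by (simp add: compact_convex_hull finite_imp_compact)
  have "measure lebesgue (convex hull {a, b, c}) = measure lebesgue (vec_of_pair ` (convex hull {a, b, c}))"
    using measure_vec_of_pair[OF comp] by simp
  also have "vec_of_pair ` (convex hull {a, b, c}) = convex hull {vec_of_pair a, vec_of_pair b, vec_of_pair c}"
    using convex_hull_linear_image[OF linear_vec_of_pair, of "{a,b,c}"] by simp
  also have "measure lebesgue \<dots> = measure lborel \<dots>"
    by (simp add: measure_completion borel_compact compact_convex_hull finite_imp_compact)
  also have "\<dots> = \<bar>(fst b - fst a) * (snd c - snd a) - (snd b - snd a) * (fst c - fst a)\<bar> / 2"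
    unfolding content_triangle by (simp add: mult.commute abs_minus_commute)
  finally show ?thesis .
qed

lemma lmeasurable_hull_finite:
  fixes V :: "'a :: euclidean_space set"
  assumes "finite V" shows "convex hull V \<in> lmeasurable"
  by (simp add: assms compact_convex_hull finite_imp_compact lmeasurable_compact)

text \<open>Twice the signed area of the triangle \<open>p\<close>, \<open>q\<close>,
  \<open>a\<close>: positive when \<open>a\<close> lies to the left of the line directed from
  \<open>p\<close> to \<open>q\<close>.\<close>

definition cross :: "real \<times> real \<Rightarrow> real \<times> real \<Rightarrow> real \<times> real \<Rightarrow> real" where
  "cross p q a = (fst q - fst p) * (snd a - snd p) - (snd q - snd p) * (fst a - fst p)"

text \<open>The two triangles over the segment from \<open>p\<close> to \<open>q\<close> lie on
  opposite sides of its line, so they overlap in a null set and their areas add up inside the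
  hull.\<close>

lemma measure_ge_opposite_triangles:
  assumes "finite V" "p \<in> convex hull V" "q \<in> convex hull V" "a \<in> convex hull V" "b \<in> convex hull V"
    and a: "0 \<le> cross p q a" and b: "cross p q b \<le> 0" and pq: "p \<noteq> q"
  shows "cross p q a - cross p q b \<le> 2 * measure lebesgue (convex hull V)"
proof -
  let ?A = "convex hull {p, q, a}" and ?B = "convex hull {p, q, b}"
  \<comment> \<open>A normal vector of the line: \<open>cross p q\<close> becomes an affine
    functional, and its sign describes a half-plane, which is convex.\<close>
  define n :: "real \<times> real" where "n = (- (snd q - snd p), fst q - fst p)"
  have cr: "cross p q z = n \<bullet> z - n \<bullet> p" for z
    by (cases z, cases p, cases q) (simp add: cross_def n_def inner_prod_def algebra_simps)
  have "?A \<subseteq> {z. n \<bullet> z \<ge> n \<bullet> p}"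
    by (rule hull_minimal) (use a cr[of a] cr[of q] in \<open>auto simp: convex_halfspace_ge cross_def\<close>)
  moreover have "?B \<subseteq> {z. n \<bullet> z \<le> n \<bullet> p}"
    by (rule hull_minimal) (use b cr[of b] cr[of q] in \<open>auto simp: convex_halfspace_le cross_def\<close>)
  ultimately have sub: "?A \<inter> ?B \<subseteq> {z. n \<bullet> z = n \<bullet> p}" by (blast intro: antisym)
  have "n \<noteq> 0" using pq by (cases p, cases q) (auto simp: n_def zero_prod_def)
  then have neg: "negligible (?A \<inter> ?B)"
    using negligible_subset[OF negligible_hyperplane sub] by auto
  have "measure lebesgue (?A \<union> ?B) = measure lebesgue ?A + measure lebesgue ?B"
    using neg by (simp add: measure_Un3 lmeasurable_hull_finite negligible_imp_measure0)
  moreover have "measure lebesgue (?A \<union> ?B) \<le> measure lebesgue (convex hull V)"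
  proof (rule measure_mono_fmeasurable)
    show "?A \<union> ?B \<subseteq> convex hull V"
      using assms(2-5) by (intro Un_least hull_minimal) auto
    show "?A \<union> ?B \<in> sets lebesgue"
      by (intro sets.Un fmeasurableD lmeasurable_hull_finite) auto
    show "convex hull V \<in> lmeasurable"
      using assms(1) by (rule lmeasurable_hull_finite)
  qed
  ultimately show ?thesis
    using a b unfolding measure_triangle_pair cross_def [symmetric] by simp
qed

section \<open>Affine unimodular maps: convex hulls and area\<close>

lemma aff_unimodular_affine:
  assumes "aff_unimodular \<phi>"
  obtains f v where "linear f" "\<phi> = (\<lambda>z. v + f z)"
    "\<bar>(fst (f (1,0))) * snd (f (0,1)) - fst (f (0,1)) * snd (f (1,0))\<bar> = 1"
proof -
  obtain a b c d e f :: int where d: "a * d - b * c = 1 \<or> a * d - b * c = -1"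
    and \<phi>: "\<And>x y. \<phi> (x, y) = (of_int a * x + of_int b * y + of_int e,
                             of_int c * x + of_int d * y + of_int f)"
    using assms unfolding aff_unimodular_def by blast
  define g :: "real \<times> real \<Rightarrow> real \<times> real" where
    "g z = (of_int a * fst z + of_int b * snd z, of_int c * fst z + of_int d * snd z)" for z
  have "real_of_int (a * d - b * c) = 1 \<or> real_of_int (a * d - b * c) = -1"
    using d by (metis of_int_1 of_int_minus)
  then have "\<bar>real_of_int a * of_int d - of_int b * of_int c\<bar> = 1" by auto
  moreover have "linear g"
    by (rule linearI) (auto simp: g_def algebra_simps)
  moreover have "\<phi> = (\<lambda>z. (of_int e, of_int f) + g z)"
    by (auto simp: \<phi> g_def)
  ultimately show thesis
    using that[of g "(of_int e, of_int f)"] by (simp add: g_def)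
qed

lemma aff_unimodular_convex_hull:
  assumes "aff_unimodular \<phi>"
  shows "\<phi> ` (convex hull V) = convex hull (\<phi> ` V)"
proof -
  obtain f v where f: "linear f" and \<phi>: "\<phi> = (\<lambda>z. v + f z)"
    using assms by (rule aff_unimodular_affine)
  have "\<phi> ` S = (+) v ` f ` S" for S by (auto simp: \<phi>)
  then show ?thesis
    by (simp only: convex_hull_linear_image[OF f] convex_hull_translation)
qed

lemma measure_aff_unimodular:
  assumes "aff_unimodular \<phi>" "compact S"
  shows "measure lebesgue (\<phi> ` S) = measure lebesgue S"
proof -
  obtain f v where f: "linear f" and \<phi>: "\<phi> = (\<lambda>z. v + f z)"
    and d: "\<bar>(fst (f (1,0))) * snd (f (0,1)) - fst (f (0,1)) * snd (f (1,0))\<bar> = 1"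
    using assms(1) by (rule aff_unimodular_affine)
  \<comment> \<open>Conjugation moves the linear part to \<open>real ^ 2\<close>, where the measure
    of an image is scaled by the absolute value of the determinant, here 1.\<close>
  let ?g = "vec_of_pair \<circ> f \<circ> pair_of_vec"
  have g: "linear ?g"
    by (intro linear_compose f linear_vec_of_pair linear_pair_of_vec)
  have "pair_of_vec (axis 1 1) = (1, 0)" "pair_of_vec (axis 2 1) = (0, 1)"
    by (auto simp: pair_of_vec_def axis_def)
  then have det: "\<bar>det (matrix ?g)\<bar> = 1"
    using d by (simp add: det_2 matrix_def)
  have cf: "compact (f ` S)"
    using f assms(2)
    by (intro compact_continuous_image linear_continuous_on) (auto simp: linear_conv_bounded_linear)
  have "measure lebesgue (\<phi> ` S) = measure lebesgue ((+) v ` (f ` S))"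
    by (simp add: \<phi> image_image)
  also have "\<dots> = measure lebesgue (vec_of_pair ` (f ` S))"
    by (simp only: measure_translation measure_vec_of_pair[OF cf])
  also have "vec_of_pair ` (f ` S) = ?g ` (vec_of_pair ` S)"
    by (simp add: image_image)
  also have "measure lebesgue \<dots> = measure lebesgue (vec_of_pair ` S)"
    using det assms(2) by (subst measure_linear_image[OF g])
      (auto intro!: lmeasurable_compact compact_continuous_image continuous_on_vec_of_pair)
  also have "\<dots> = measure lebesgue S"
    using assms(2) by (rule measure_vec_of_pair)
  finally show ?thesis .
qed

section \<open>Lattice point configurations\<close>

lemma aff_unimodular_compose:
  assumes "aff_unimodular \<phi>" "aff_unimodular \<psi>"
  shows "aff_unimodular (\<psi> \<circ> \<phi>)"
proof -
  obtain a b c d e f :: int where 1: "a * d - b * c = 1 \<or> a * d - b * c = -1"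
    and \<phi>: "\<And>x y. \<phi> (x, y) = (of_int a * x + of_int b * y + of_int e,
                             of_int c * x + of_int d * y + of_int f)"
    using assms(1) unfolding aff_unimodular_def by blast
  obtain a' b' c' d' e' f' :: int where 2: "a' * d' - b' * c' = 1 \<or> a' * d' - b' * c' = -1"
    and \<psi>: "\<And>x y. \<psi> (x, y) = (of_int a' * x + of_int b' * y + of_int e',
                             of_int c' * x + of_int d' * y + of_int f')"
    using assms(2) unfolding aff_unimodular_def by blast
  have "(a' * a + b' * c) * (c' * b + d' * d) - (a' * b + b' * d) * (c' * a + d' * c) =
      (a' * d' - b' * c') * (a * d - b * c)"
    by (simp add: algebra_simps)
  moreover have "(a' * d' - b' * c') * (a * d - b * c) = 1 \<or> (a' * d' - b' * c') * (a * d - b * c) = -1"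
    using 1 2 by (elim disjE) simp_all
  ultimately have det: "(a' * a + b' * c) * (c' * b + d' * d) - (a' * b + b' * d) * (c' * a + d' * c) = 1 \<or>
      (a' * a + b' * c) * (c' * b + d' * d) - (a' * b + b' * d) * (c' * a + d' * c) = -1"
    by simp
  have eq: "(\<psi> \<circ> \<phi>) (x, y) =
      (of_int (a' * a + b' * c) * x + of_int (a' * b + b' * d) * y + of_int (a' * e + b' * f + e'),
       of_int (c' * a + d' * c) * x + of_int (c' * b + d' * d) * y + of_int (c' * e + d' * f + f'))" for x y
    by (simp add: \<phi> \<psi> algebra_simps)
  show ?thesis
    unfolding aff_unimodular_def
    by (rule exI[of _ "a' * a + b' * c"], rule exI[of _ "a' * b + b' * d"], rule exI[of _ "c' * a + d' * c"],
        rule exI[of _ "c' * b + d' * d"], rule exI[of _ "a' * e + b' * f + e'"], rule exI[of _ "c' * e + d' * f + f'"])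
       (rule conjI[OF det], intro allI, rule eq)
qed

lemma lattice_equiv_trans:
  "lattice_equiv P Q \<Longrightarrow> lattice_equiv Q R \<Longrightarrow> lattice_equiv P R"
  unfolding lattice_equiv_def by (metis aff_unimodular_compose image_comp)

lemma lattice_equiv_refl: "lattice_equiv P P"
proof -
  have "aff_unimodular id"
    unfolding aff_unimodular_def
    by (intro exI[of _ 1] exI[of _ 0]) (simp; intro exI[of _ 0] exI[of _ 1]; simp)
  then show ?thesis unfolding lattice_equiv_def by auto
qed

lemma measure_lattice_equiv:
  "lattice_equiv P Q \<Longrightarrow> compact P \<Longrightarrow> measure lebesgue P = measure lebesgue Q"
  unfolding lattice_equiv_def by (elim exE conjE) (simp flip: measure_aff_unimodular)

section \<open>Unimodular maps and areas in integer coordinates\<close>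

definition int_unimodular :: "(int \<times> int \<Rightarrow> int \<times> int) \<Rightarrow> bool" where
  "int_unimodular g \<longleftrightarrow> (\<exists>a b c d e f. (a * d - b * c = 1 \<or> a * d - b * c = -1) \<and>
     g = (\<lambda>(x, y). (a * x + b * y + e, c * x + d * y + f)))"

lemma int_unimodularI:
  "a * d - b * c = 1 \<or> a * d - b * c = -1 \<Longrightarrow>
    int_unimodular (\<lambda>(x, y). (a * x + b * y + e, c * x + d * y + f))"
  unfolding int_unimodular_def by blast

lemma int_unimodular_compose:
  assumes "int_unimodular g" "int_unimodular h"
  shows "int_unimodular (h \<circ> g)"
proof -
  obtain a b c d e f where 1: "a * d - b * c = 1 \<or> a * d - b * c = -1"
    and g: "g = (\<lambda>(x, y). (a * x + b * y + e, c * x + d * y + f))"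
    using assms(1) unfolding int_unimodular_def by blast
  obtain a' b' c' d' e' f' where 2: "a' * d' - b' * c' = 1 \<or> a' * d' - b' * c' = -1"
    and h: "h = (\<lambda>(x, y). (a' * x + b' * y + e', c' * x + d' * y + f'))"
    using assms(2) unfolding int_unimodular_def by blast
  have "(a' * a + b' * c) * (c' * b + d' * d) - (a' * b + b' * d) * (c' * a + d' * c) =
      (a' * d' - b' * c') * (a * d - b * c)"
    by (simp add: algebra_simps)
  then have 3: "(a' * a + b' * c) * (c' * b + d' * d) - (a' * b + b' * d) * (c' * a + d' * c) = 1 \<or>
      (a' * a + b' * c) * (c' * b + d' * d) - (a' * b + b' * d) * (c' * a + d' * c) = -1"
    using 1 2 by auto
  have "h \<circ> g = (\<lambda>(x, y). ((a' * a + b' * c) * x + (a' * b + b' * d) * y + (a' * e + b' * f + e'),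
      (c' * a + d' * c) * x + (c' * b + d' * d) * y + (c' * e + d' * f + f')))"
    by (auto simp: g h algebra_simps)
  then show ?thesis using int_unimodularI[OF 3] by simp
qed

definition real_point :: "int \<times> int \<Rightarrow> real \<times> real" where
  "real_point p = (of_int (fst p), of_int (snd p))"

lemma real_point_Pair [simp]: "real_point (x, y) = (of_int x, of_int y)"
  by (simp add: real_point_def)

text \<open>\<open>W\<close> is any generating set of lattice points, not just the vertices, so
  points inside the polygon may remain in \<open>W\<close> throughout the case analysis.\<close>

definition lhull :: "(int \<times> int) set \<Rightarrow> (real \<times> real) set" where
  "lhull W = convex hull (real_point ` W)"

lemma compact_lhull: "finite W \<Longrightarrow> compact (lhull W)"
  by (simp add: lhull_def compact_convex_hull finite_imp_compact)

text \<open>The same integer coefficients define a map of the plane that commutes with convex hulls.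
  Hence all later coordinate changes can be made on integer points.\<close>

lemma int_unimodular_lift:
  assumes "int_unimodular g"
  obtains \<phi> where "aff_unimodular \<phi>" "\<And>W. \<phi> ` lhull W = lhull (g ` W)"
proof -
  obtain a b c d e f where 1: "a * d - b * c = 1 \<or> a * d - b * c = -1"
    and g: "g = (\<lambda>(x, y). (a * x + b * y + e, c * x + d * y + f))"
    using assms(1) unfolding int_unimodular_def by blast
  define \<phi> :: "real \<times> real \<Rightarrow> real \<times> real" where
    "\<phi> = (\<lambda>(x, y). (of_int a * x + of_int b * y + of_int e, of_int c * x + of_int d * y + of_int f))"
  have \<phi>: "aff_unimodular \<phi>"
    unfolding aff_unimodular_def \<phi>_def using 1
    by (rule_tac x = a in exI, rule_tac x = b in exI, rule_tac x = c in exI, rule_tac x = d in exI,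
        rule_tac x = e in exI, rule_tac x = f in exI) simp
  have "\<phi> (real_point p) = real_point (g p)" for p
    by (cases p) (simp add: \<phi>_def g)
  then have "\<phi> ` lhull W = lhull (g ` W)" for W
    by (simp add: lhull_def aff_unimodular_convex_hull[OF \<phi>] image_image)
  with \<phi> that show thesis by blast
qed

lemma lattice_equiv_lhull: "int_unimodular g \<Longrightarrow> lattice_equiv (lhull W) (lhull (g ` W))"
  unfolding lattice_equiv_def by (rule int_unimodular_lift) auto

text \<open>Doubling turns triangle areas into the integers \<open>icross\<close>, directly
  comparable with the integer sizes in \<open>fits\<close>.\<close>

definition area2 :: "(int \<times> int) set \<Rightarrow> real" where
  "area2 W = 2 * measure lebesgue (lhull W)"

lemma area2_unimodular: "int_unimodular g \<Longrightarrow> finite W \<Longrightarrow> area2 (g ` W) = area2 W"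
  unfolding area2_def by (metis compact_lhull lattice_equiv_lhull measure_lattice_equiv)

definition icross :: "int \<times> int \<Rightarrow> int \<times> int \<Rightarrow> int \<times> int \<Rightarrow> int" where
  "icross p q a = (fst q - fst p) * (snd a - snd p) - (snd q - snd p) * (fst a - fst p)"

lemma area2_ge_icross:
  assumes "finite W" "p \<in> W" "q \<in> W" "a \<in> W" "b \<in> W"
    and "0 \<le> icross p q a" "icross p q b \<le> 0" "p \<noteq> q"
  shows "of_int (icross p q a - icross p q b) \<le> area2 W"
proof -
  have c: "cross (real_point p) (real_point q) (real_point z) = of_int (icross p q z)" for z
    by (simp add: cross_def icross_def real_point_def)
  have "real_point p \<noteq> real_point q"
    using \<open>p \<noteq> q\<close> by (auto simp: real_point_def prod_eq_iff)
  then have "cross (real_point p) (real_point q) (real_point a)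
      - cross (real_point p) (real_point q) (real_point b) \<le> 2 * measure lebesgue (convex hull (real_point ` W))"
    using assms by (intro measure_ge_opposite_triangles) (auto simp: c hull_inc)
  then show ?thesis by (simp add: c area2_def lhull_def)
qed

section \<open>Certificates for upper bounds on the simplex size\<close>

definition fits :: "(int \<times> int) set \<Rightarrow> int \<Rightarrow> bool" where
  "fits W k \<longleftrightarrow> (\<exists>g. int_unimodular g \<and>
     (\<forall>p\<in>W. 0 \<le> fst (g p) \<and> 0 \<le> snd (g p) \<and> fst (g p) + snd (g p) \<le> k))"

lemma fitsI:
  assumes "a * d - b * c = 1 \<or> a * d - b * c = -1"
    and "\<And>x y. (x, y) \<in> W \<Longrightarrow> 0 \<le> a * x + b * y + e \<and> 0 \<le> c * x + d * y + f \<and>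
      a * x + b * y + e + (c * x + d * y + f) \<le> k"
  shows "fits W k"
  unfolding fits_def using int_unimodularI[OF assms(1), of e f] assms(2) by fastforce

lemma fits_unimodular: "int_unimodular g \<Longrightarrow> fits (g ` W) k \<Longrightarrow> fits W k"
  unfolding fits_def using int_unimodular_compose by fastforce

lemma std_simplexI: "0 \<le> x \<Longrightarrow> 0 \<le> y \<Longrightarrow> x + y \<le> 1 \<Longrightarrow> (x, y) \<in> std_simplex"
  unfolding std_simplex_def convex_hull_3
  by (intro CollectI exI[of _ "1 - x - y"] exI[of _ x] exI[of _ y]) auto

text \<open>A dilate of the simplex is convex, so it contains the whole image polygon once it
  contains the images of the generators. Thus \<open>fits W k\<close> exhibits \<open>k\<close> as a
  member of the set whose infimum is taken.\<close>

lemma ls_Delta_le: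
  assumes "fits W k" "0 \<le> k"
  shows "ls_Delta (lhull W) \<le> of_int k"
proof -
  obtain g where g: "int_unimodular g"
    and b: "\<And>p. p \<in> W \<Longrightarrow> 0 \<le> fst (g p) \<and> 0 \<le> snd (g p) \<and> fst (g p) + snd (g p) \<le> k"
    using assms(1) unfolding fits_def by blast
  obtain \<phi> where \<phi>: "aff_unimodular \<phi>" "\<And>W. \<phi> ` lhull W = lhull (g ` W)"
    using int_unimodular_lift[OF g] by blast
  let ?S = "(\<lambda>z. of_int k *\<^sub>R z) ` std_simplex"
  have conv: "convex ?S"
    by (intro convex_scaling) (simp add: std_simplex_def)
  have mem: "(x, y) \<in> ?S" if "0 \<le> x" "0 \<le> y" "x + y \<le> of_int k" for x y :: real
  \<comment> \<open>Membership is shown by dividing by \<open>k\<close>, so the dilate that is only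
    the origin is treated apart.\<close>
  proof (cases "k = 0")
    case True
    then have "(x, y) = of_int k *\<^sub>R (0, 0)" using that by auto
    then show ?thesis by (rule image_eqI) (simp add: std_simplexI)
  next
    case False
    with assms(2) have k: "0 < real_of_int k" by simp
    have "(x, y) = of_int k *\<^sub>R (x / of_int k, y / of_int k)" using k by simp
    then show ?thesis
      by (rule image_eqI) (use that k in \<open>auto intro!: std_simplexI simp: field_simps\<close>)
  qed
  have "lhull (g ` W) \<subseteq> ?S"
    unfolding lhull_def
  proof (rule hull_minimal)
    show "real_point ` g ` W \<subseteq> ?S"
    proof (rule image_subsetI)
    fix q assume "q \<in> g ` W"
    with b have "0 \<le> fst q" "0 \<le> snd q" "fst q + snd q \<le> k" by blast+
    then show "real_point q \<in> ?S"
      unfolding real_point_def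
      by (intro mem) (simp_all flip: of_int_add)
    qed
    show "convex ?S" by (rule conv)
  qed
  then have "of_int k \<in> {l. l \<ge> 0 \<and> (\<exists>\<phi>. aff_unimodular \<phi> \<and> \<phi> ` lhull W \<subseteq> (\<lambda>z. l *\<^sub>R z) ` std_simplex)}"
    using \<phi> assms(2) by (simp only: mem_Collect_eq of_int_0_le_iff) (metis)
  then show ?thesis
    unfolding ls_Delta_def by (rule cInf_lower) (auto intro: bdd_belowI[of _ 0])
qed

section \<open>The extremal polygons and the alternative to be proved\<close>

lemma cbox_unit_square: "cbox (0, 0) (1, 1 :: real) = lhull {(0, 0), (1, 0), (0, 1), (1, 1)}"
proof -
  have "lhull {(0, 0), (1, 0), (0, 1), (1, 1)} = convex hull ({0, 1 :: real} \<times> {0, 1 :: real})"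
    unfolding lhull_def by (rule arg_cong[where f = "\<lambda>S. convex hull S"]) auto
  also have "\<dots> = {0..1} \<times> {0..1}"
    unfolding convex_hull_Times segment_convex_hull [symmetric] by (simp add: closed_segment_eq_real_ivl)
  finally show ?thesis by (simp add: cbox_Pair_eq)
qed

abbreviation thin_triangle :: "real \<Rightarrow> (real \<times> real) set" where
  "thin_triangle b \<equiv> convex hull {(0, 0), (b, 0), (0, 1)}"

abbreviation wide_triangle :: "(real \<times> real) set" where
  "wide_triangle \<equiv> convex hull {(0, 0), (1, 2), (2, 1)}"

lemma measure_thin_triangle: "0 \<le> b \<Longrightarrow> measure lebesgue (thin_triangle b) = b / 2"
  by (simp add: measure_triangle_pair)

lemma measure_wide_triangle: "measure lebesgue wide_triangle = 3 / 2"
  by (simp add: measure_triangle_pair)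

lemma measure_unit_square: "measure lebesgue (cbox (0, 0) (1 :: real, 1 :: real)) = 1"
  by (simp add: measure_lborel_cbox_eq Basis_prod_def Basis_real_def)

text \<open>Only upper bounds for \<open>ls_Delta\<close> appear, through \<open>fits\<close>. In
  the last three alternatives the doubled area equals the size that is fitted, so no lower bound for
  \<open>ls_Delta\<close> has to be proved separately.\<close>

definition area_bound :: "(int \<times> int) set \<Rightarrow> bool" where
  "area_bound W \<longleftrightarrow>
     (\<exists>k\<ge>0. fits W k \<and> of_int k < area2 W)
     \<or> (\<exists>b\<ge>1. fits W b \<and> lattice_equiv (lhull W) (thin_triangle (of_int b)))
     \<or> (fits W 2 \<and> lattice_equiv (lhull W) (cbox (0, 0) (1, 1)))
     \<or> (fits W 3 \<and> lattice_equiv (lhull W) wide_triangle)"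

lemma area_bound_unimodular:
  assumes "int_unimodular g" "finite W" "area_bound (g ` W)"
  shows "area_bound W"
proof -
  have f: "fits W k" if "fits (g ` W) k" for k
    using fits_unimodular[OF assms(1) that] .
  have e: "lattice_equiv (lhull W) Q" if "lattice_equiv (lhull (g ` W)) Q" for Q
    using lattice_equiv_trans[OF lattice_equiv_lhull[OF assms(1)] that] .
  show ?thesis
    using assms(3) unfolding area_bound_def area2_unimodular[OF assms(1,2)]
    by (auto dest: f e)
qed

text \<open>For an extremal type of size \<open>b\<close> the area is b/2 and
  \<open>ls_Delta P\<close> is at most \<open>b\<close>; equality in the area bound then forces
  \<open>ls_Delta P\<close> to be \<open>b\<close>, the parameter required by the type. The converse
  only evaluates the areas of the listed polygons.\<close>

lemma area_bound_imp:
  assumes "finite W" "area_bound W"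
  defines "P \<equiv> lhull W"
  shows "measure lebesgue P \<ge> ls_Delta P / 2
    \<and> (measure lebesgue P = ls_Delta P / 2 \<longleftrightarrow>
        ((ls_Delta P \<ge> 1 \<and> lattice_equiv P (thin_triangle (ls_Delta P)))
         \<or> (ls_Delta P = 2 \<and> lattice_equiv P (cbox (0, 0) (1, 1)))
         \<or> (ls_Delta P = 3 \<and> lattice_equiv P wide_triangle)))" (is "?ge \<and> (?eq \<longleftrightarrow> ?types)")
proof -
  have comp: "compact P" using assms by (simp add: compact_lhull)
  have m: "measure lebesgue P = measure lebesgue Q" if "lattice_equiv P Q" for Q
    using measure_lattice_equiv[OF that comp] .
  have eq_thin: "measure lebesgue P = b / 2" if "lattice_equiv P (thin_triangle b)" "1 \<le> b" for b
    using m[OF that(1)] measure_thin_triangle[of b] that(2) by linarith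
  have eq_square: "measure lebesgue P = 1" if "lattice_equiv P (cbox (0, 0) (1, 1))"
    using m[OF that] measure_unit_square by linarith
  have eq_wide: "measure lebesgue P = 3 / 2" if "lattice_equiv P wide_triangle"
    using m[OF that] measure_wide_triangle by linarith
  have types_imp: "?eq" if "?types"
    using that
  proof (elim disjE conjE)
    assume "1 \<le> ls_Delta P" "lattice_equiv P (thin_triangle (ls_Delta P))"
    then show "?eq" by (intro eq_thin)
  next
    assume "ls_Delta P = 2" "lattice_equiv P (cbox (0, 0) (1, 1))"
    then show "?eq" using eq_square by linarith
  next
    assume "ls_Delta P = 3" "lattice_equiv P wide_triangle"
    then show "?eq" using eq_wide by linarith
  qed
  consider (strict) k where "k \<ge> 0" "fits W k" "of_int k < area2 W"
    | (thin) b where "b \<ge> 1" "fits W b" "lattice_equiv P (thin_triangle (of_int b))"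
    | (square) "fits W 2" "lattice_equiv P (cbox (0, 0) (1, 1))"
    | (wide) "fits W 3" "lattice_equiv P wide_triangle"
    using assms(2) unfolding area_bound_def P_def by blast
  then have "?ge \<and> (?eq \<longrightarrow> ?types)"
  proof cases
    case strict
    then have "ls_Delta P < 2 * measure lebesgue P"
      using ls_Delta_le[of W k] unfolding P_def area2_def by linarith
    then show ?thesis by linarith
  next
    case (thin b)
    then have le: "ls_Delta P \<le> of_int b" using ls_Delta_le[of W b] unfolding P_def by linarith
    have area: "measure lebesgue P = of_int b / 2" and b: "1 \<le> real_of_int b"
      using eq_thin[OF thin(3)] thin(1) by auto
    have "?types" if "?eq"
    proof -
      have "ls_Delta P = of_int b" using that area by linarith
      with b thin(3) show ?thesis by metis
    qed
    with le area show ?thesis by linarith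
  next
    case square
    then have "ls_Delta P \<le> 2" using ls_Delta_le[of W 2] unfolding P_def by linarith
    moreover have "measure lebesgue P = 1"
      using eq_square[OF square(2)] by linarith
    moreover have "?types" if "ls_Delta P = 2" using that square(2) by blast
    ultimately show ?thesis by linarith
  next
    case wide
    then have "ls_Delta P \<le> 3" using ls_Delta_le[of W 3] unfolding P_def by linarith
    moreover have "measure lebesgue P = 3 / 2"
      using eq_wide[OF wide(2)] by linarith
    moreover have "?types" if "ls_Delta P = 3" using that wide(2) by blast
    ultimately show ?thesis by linarith
  qed
  with types_imp show ?thesis by blast
qed

lemma lhull_eqI:
  assumes "S \<subseteq> W" "real_point ` W \<subseteq> lhull S"
  shows "lhull W = lhull S"
proof
  show "lhull W \<subseteq> lhull S"
    using hull_minimal[OF assms(2)] by (simp add: lhull_def)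
  show "lhull S \<subseteq> lhull W"
    using assms(1) by (auto simp: lhull_def intro!: hull_mono)
qed

section \<open>Narrow strips\<close>

lemma finite_ex_max:
  fixes f :: "'a \<Rightarrow> 'b :: linorder"
  assumes "finite A" "A \<noteq> {}"
  shows "\<exists>p\<in>A. \<forall>q\<in>A. f q \<le> f p"
proof -
  have "Max (f ` A) \<in> f ` A" using assms by (intro Max_in) auto
  then obtain p where "p \<in> A" "f p = Max (f ` A)" by auto
  then show ?thesis using assms(1) by (metis Max_ge finite_imageI imageI)
qed

text \<open>Every strict inequality below comes from this rule: a fit of size \<open>k\<close>, and
  two triangles on opposite sides of a segment with total doubled area above
  \<open>k\<close>.\<close>

lemma area_boundI:
  assumes "finite W" "fits W k" "0 \<le> k" "p \<in> W" "q \<in> W" "a \<in> W" "b \<in> W"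
    and "0 \<le> icross p q a" "icross p q b \<le> 0" "p \<noteq> q" "k < icross p q a - icross p q b"
  shows "area_bound W"
proof -
  have "of_int k < area2 W"
    using area2_ge_icross[OF assms(1,4-10)] assms(11) by linarith
  then show ?thesis unfolding area_bound_def using assms(2,3) by blast
qed

lemma area_bound_thin_triangle:
  assumes "(0, 0) \<in> W" "(b, 0) \<in> W" "(0, 1) \<in> W" "1 \<le> b"
    and W: "\<And>x y. (x, y) \<in> W \<Longrightarrow> y = 0 \<and> 0 \<le> x \<and> x \<le> b \<or> x = 0 \<and> y = 1"
  shows "area_bound W"
proof -
  let ?S = "{(0, 0), (b, 0), (0, 1)}"
  have S: "lhull ?S = thin_triangle (of_int b)" by (simp add: lhull_def)
  have "lhull W = lhull ?S"
  proof (rule lhull_eqI)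
    show "?S \<subseteq> W" using assms by auto
    have "real_point (x, y) \<in> lhull ?S" if "(x, y) \<in> W" for x y
      using W[OF that]
    proof
      assume "y = 0 \<and> 0 \<le> x \<and> x \<le> b"
      with \<open>1 \<le> b\<close> have "real_point (x, y) = (1 - of_int x / of_int b) *\<^sub>R (0, 0)
          + (of_int x / of_int b) *\<^sub>R (of_int b, 0) + 0 *\<^sub>R (0, 1)"
        "0 \<le> real_of_int x / of_int b" "real_of_int x / of_int b \<le> 1" by auto
      then show ?thesis unfolding S convex_hull_3
        by (intro CollectI exI[of _ "1 - of_int x / of_int b"] exI[of _ "of_int x / of_int b"] exI[of _ 0]) auto
    qed (simp add: lhull_def hull_inc)
    then show "real_point ` W \<subseteq> lhull ?S" by auto
  qed
  moreover have "fits W b"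
    by (rule fitsI[of 1 1 0 0 _ 0 0]) (use W \<open>1 \<le> b\<close> in force)+
  ultimately show ?thesis
    unfolding area_bound_def S using assms(4) lattice_equiv_refl by auto
qed

lemma area_bound_unit_square:
  assumes "W = {(0, 0), (1, 0), (0, 1), (1, 1)}"
  shows "area_bound W"
proof -
  have "lattice_equiv (lhull W) (cbox (0, 0) (1, 1))"
    unfolding assms cbox_unit_square by (rule lattice_equiv_refl)
  moreover have "fits W 2"
    by (rule fitsI[of 1 1 0 0 _ 0 0]) (auto simp: assms)
  ultimately show ?thesis unfolding area_bound_def by blast
qed

lemma area_bound_wide_triangle:
  assumes "{(0, 0), (1, 2), (2, 1)} \<subseteq> W" "W \<subseteq> {(0, 0), (1, 2), (2, 1), (1, 1)}"
  shows "area_bound W"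
proof -
  let ?S = "{(0, 0), (1, 2), (2, 1)}"
  have S: "lhull ?S = wide_triangle" by (simp add: lhull_def)
  have "lhull W = lhull ?S"
  proof (rule lhull_eqI)
    \<comment> \<open>This point is the centroid of the triangle, hence all three weights are
      1/3.\<close>
    have "real_point (1, 1) \<in> wide_triangle"
      unfolding convex_hull_3
      by (intro CollectI exI[of _ "1 / 3"]) simp
    then have "real_point ` {(0, 0), (1, 2), (2, 1), (1, 1)} \<subseteq> lhull ?S"
      unfolding S by (auto simp: hull_inc)
    then show "real_point ` W \<subseteq> lhull ?S" using assms(2) by blast
  qed (use assms in auto)
  moreover have "fits W 3"
    by (rule fitsI[of 1 1 0 0 _ 0 0]) (use assms in auto)
  ultimately show ?thesis
    unfolding area_bound_def S by (metis lattice_equiv_refl)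
qed

text \<open>The point configurations of minimal lattice width \<open>w\<close>, where \<open>(0, 0)\<close> and \<open>(t, w)\<close> are the
  leftmost points on the two supporting lines of the narrowest strip.\<close>

locale narrow_strip =
  fixes W :: "(int \<times> int) set" and t w :: int
  assumes finite: "finite W"
    and bottom: "(0, 0) \<in> W" and top: "(t, w) \<in> W"
    and t: "0 \<le> t" "t < w"
    and row: "(x, y) \<in> W \<Longrightarrow> 0 \<le> y \<and> y \<le> w"
    and left_bottom: "(x, 0) \<in> W \<Longrightarrow> 0 \<le> x"
    and left_top: "(x, w) \<in> W \<Longrightarrow> t \<le> x"
    and width: "int_unimodular g \<Longrightarrow> \<exists>p\<in>W. \<not> (c \<le> snd (g p) \<and> snd (g p) < c + w)"
begin

section \<open>Two test directions for the width, and strips of width 1\<close>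

lemma width_x:
  assumes "\<And>x y. (x, y) \<in> W \<Longrightarrow> c \<le> x \<and> x < c + w"
  shows False
  using width[OF int_unimodularI[of 0 0 1 1 0 0], of c] assms by force

text \<open>Minimality of \<open>w\<close> is tested only in the directions x (after swapping
  coordinates) and y - x (after the shear used here): in neither may \<open>W\<close> occupy just
  \<open>w\<close> consecutive integer values.\<close>

lemma width_diff:
  assumes "\<And>x y. (x, y) \<in> W \<Longrightarrow> c \<le> y - x \<and> y - x < c + w"
  shows False
  using width[OF int_unimodularI[of 1 1 0 "-1" 0 0], of c] assms by force

text \<open>The hull is a trapezoid with parallel sides of lengths \<open>b\<close> (bottom) and
  \<open>a\<close> (top), so its doubled area is a + b. It fits size max(b, a + 1), and after
  exchanging the rows size max(a, b + 1). One of these is below a + b unless a side is a point or a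
  = b = 1. Two degenerate sides would leave a single column, against the width.\<close>

lemma area_bound_width_1:
  assumes w: "w = 1"
  shows "area_bound W"
proof -
  have t0: "t = 0" using t w by simp
  have row_max: "\<exists>p\<in>W. snd p = c \<and> (\<forall>r\<in>W. snd r = c \<longrightarrow> fst r \<le> fst p)" if "(z, c) \<in> W" for z c
  proof -
    have "finite {p \<in> W. snd p = c}" "{p \<in> W. snd p = c} \<noteq> {}"
      using finite that by auto
    then have "\<exists>p\<in>{p \<in> W. snd p = c}. \<forall>q\<in>{p \<in> W. snd p = c}. fst q \<le> fst p"
      by (rule finite_ex_max)
    then show ?thesis by blast
  qed
  obtain p where p: "p \<in> W" "snd p = 0" "\<And>r. r \<in> W \<Longrightarrow> snd r = 0 \<Longrightarrow> fst r \<le> fst p"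
    using row_max[OF bottom] by blast
  obtain q where q: "q \<in> W" "snd q = 1" "\<And>r. r \<in> W \<Longrightarrow> snd r = 1 \<Longrightarrow> fst r \<le> fst q"
    using row_max[OF top] unfolding w by blast
  define b a where "b = fst p" and "a = fst q"
  have pq: "(b, 0) \<in> W" "(a, 1) \<in> W" using p(1,2) q(1,2) unfolding a_def b_def by (metis prod.collapse)+
  have W: "y = 0 \<and> 0 \<le> x \<and> x \<le> b \<or> y = 1 \<and> 0 \<le> x \<and> x \<le> a" if "(x, y) \<in> W" for x y
  proof -
    have "y = 0 \<or> y = 1" using row[OF that] w by auto
    then show ?thesis
      using p(3)[OF that] q(3)[OF that] left_bottom[of x] left_top[of x] that t0 w
      by (auto simp: a_def b_def)
  qed
  have "0 \<le> a" "0 \<le> b" using W[OF pq(1)] W[OF pq(2)] by auto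
  then consider "a = 0" "b = 0" | "a = 0" "1 \<le> b" | "1 \<le> a" "b = 0" | "1 \<le> a" "2 \<le> b"
    | "2 \<le> a" "1 \<le> b" | "a = 1" "b = 1" by linarith
  then show ?thesis
  proof cases
    case 1
    have False by (rule width_x[of 0]) (use W 1 w in force)
    then show ?thesis ..
  next
    case 2
    show ?thesis
      by (rule area_bound_thin_triangle[of _ b]) (use bottom top pq W 2 w in force)+
  next
    case 3
    \<comment> \<open>Exchanging the two rows moves the long side to the bottom, as the thin
      triangle requires.\<close>
    let ?g = "\<lambda>(x, y). (1 * x + 0 * y + 0, 0 * x + (-1) * y + 1 :: int)"
    have "area_bound (?g ` W)"
    proof (rule area_bound_thin_triangle[of _ a])
      show "(0, 0) \<in> ?g ` W" "(a, 0) \<in> ?g ` W" "(0, 1) \<in> ?g ` W"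
        using pq bottom top t0 w by (force simp: image_iff)+
    qed (use W 3 in force)+
    then show ?thesis
      using area_bound_unimodular[OF int_unimodularI[of 1 "-1" 0 0 0 1] finite] by simp
  next
    case 4
    have "fits W (max b (a + 1))"
      by (rule fitsI[of 1 1 0 0 _ 0 0]) (use W in force)+
    \<comment> \<open>The diagonal from (0, 0) to (a, 1) cuts off triangles of doubled areas
      \<open>a\<close> and \<open>b\<close>.\<close>
    then show ?thesis
      by (rule area_boundI[OF finite _ _ bottom pq(2) top pq(1)]) (use 4 t0 w in \<open>auto simp: icross_def\<close>)
  next
    case 5
    have "fits W (max a (b + 1))"
      by (rule fitsI[of 1 "-1" 0 0 _ 0 1]) (use W in force)+
    then show ?thesis
      by (rule area_boundI[OF finite _ _ bottom pq(2) top pq(1)]) (use 5 t0 w in \<open>auto simp: icross_def\<close>)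
  next
    case 6
    have "W \<subseteq> {(0, 0), (1, 0), (0, 1), (1, 1)}"
      using W 6 by (auto; smt (verit))
    then have "W = {(0, 0), (1, 0), (0, 1), (1, 1)}"
      using pq bottom top t0 w 6 by auto
    then show ?thesis by (rule area_bound_unit_square)
  qed
qed

end

section \<open>Deviations from the segment between the two sides of the strip\<close>

lemma le_div_int: "0 < w \<Longrightarrow> w * a \<le> m \<Longrightarrow> a \<le> m div w" for a m w :: int
  by (metis nonzero_mult_div_cancel_left order_less_irrefl zdiv_mono1)

context narrow_strip
begin

text \<open>The deviation t y - w x is \<open>icross\<close> over the segment from (0, 0) to (t, w),
  so the two extreme points span triangles of total doubled area m + n.\<close>

lemma area_bound_of_deviations:
  assumes "fits W k" "0 \<le> k" "k < m + n" "0 \<le> m" "0 \<le> n"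
    and "(x, y) \<in> W" "t * y - w * x = m" "(x', y') \<in> W" "t * y' - w * x' = - n"
  shows "area_bound W"
  by (rule area_boundI[OF finite assms(1,2) bottom top assms(6,8)])
     (use assms t in \<open>auto simp: icross_def\<close>)

text \<open>The extreme values have the stated signs because the deviation vanishes at (0,
  0).\<close>

lemma deviations:
  obtains m n x y x' y' where "0 \<le> m" "0 \<le> n"
    "(x, y) \<in> W" "t * y - w * x = m" "(x', y') \<in> W" "t * y' - w * x' = - n"
    "\<And>x y. (x, y) \<in> W \<Longrightarrow> - n \<le> t * y - w * x \<and> t * y - w * x \<le> m"
proof -
  let ?D = "\<lambda>p. t * snd p - w * fst p"
  have ne: "W \<noteq> {}" using bottom by auto
  obtain p where p: "p \<in> W" "\<forall>q\<in>W. ?D q \<le> ?D p"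
    using finite_ex_max[OF finite ne, of ?D] by blast
  obtain q where q: "q \<in> W" "\<forall>r\<in>W. - ?D r \<le> - ?D q"
    using finite_ex_max[OF finite ne, of "\<lambda>p. - ?D p"] by blast
  show thesis
  proof (rule that[of "?D p" "- ?D q" "fst p" "snd p" "fst q" "snd q"])
    show "0 \<le> ?D p" "0 \<le> - ?D q" using p(2) q(2) bottom by force+
    show "- (- ?D q) \<le> t * y - w * x \<and> t * y - w * x \<le> ?D p" if "(x, y) \<in> W" for x y
      using p(2) q(2) that by force
  qed (use p q in auto)
qed

context
  fixes m n x1 y1 x2 y2 \<mu> \<nu> :: int
  assumes m0: "0 \<le> m" and n0: "0 \<le> n"
    and m_point: "(x1, y1) \<in> W" "t * y1 - w * x1 = m"
    and n_point: "(x2, y2) \<in> W" "t * y2 - w * x2 = - n"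
    and dev: "\<And>x y. (x, y) \<in> W \<Longrightarrow> - n \<le> t * y - w * x \<and> t * y - w * x \<le> m"
  defines "\<mu> \<equiv> m div w" and "\<nu> \<equiv> n div w"
begin

lemmas strict = area_bound_of_deviations[OF _ _ _ m0 n0 m_point n_point]

text \<open>Each bound is an integer inequality divided by \<open>w\<close> and rounded down. With D
  = t y - w x, the quantities w (-x) = D - t y and w (y - x - (w - t)) = D - (w - t) (w - y) are at
  most \<open>m\<close>, while w (x - t) = -D - t (w - y) and w (x - y) = -D - (w - t) y are at most
  \<open>n\<close>.\<close>

lemma x_bounds:
  assumes "(x, y) \<in> W"
  shows "- \<mu> \<le> x" "x \<le> t + \<nu>" "x - y \<le> \<nu>" "y - x \<le> w - t + \<mu>"
proof -
  have w: "0 < w" using t by simp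
  note D = dev[OF assms]
  have y: "0 \<le> y" "y \<le> w" using row[OF assms] by auto
  have 1: "0 \<le> t * y" "t * y \<le> t * w" "(w - t) * y \<le> (w - t) * w" "0 \<le> (w - t) * y"
    using y t by (auto intro: mult_left_mono)
  have "- x \<le> m div w" by (rule le_div_int[OF w]) (use D 1 in \<open>simp add: algebra_simps\<close>)
  then show "- \<mu> \<le> x" by (simp add: \<mu>_def)
  have "x - t \<le> n div w" by (rule le_div_int[OF w]) (use D 1 in \<open>simp add: algebra_simps\<close>)
  then show "x \<le> t + \<nu>" by (simp add: \<nu>_def)
  have "x - y \<le> n div w" by (rule le_div_int[OF w]) (use D 1 in \<open>simp add: algebra_simps\<close>)
  then show "x - y \<le> \<nu>" by (simp add: \<nu>_def)
  have "y - x - (w - t) \<le> m div w" by (rule le_div_int[OF w]) (use D 1 in \<open>simp add: algebra_simps\<close>)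
  then show "y - x \<le> w - t + \<mu>" by (simp add: \<mu>_def)
qed

lemma floors_nonneg: "0 \<le> \<mu>" "0 \<le> \<nu>"
  using m0 n0 t by (simp_all add: \<mu>_def \<nu>_def pos_imp_zdiv_nonneg_iff)

text \<open>The map (x, y) to (x + \<mu>, w - y) makes the three sides of the simplex out of x \<ge>
  -\<mu>, y \<le> w and x - y \<le> \<nu>.\<close>

lemma fits_strip: "fits W (w + \<mu> + \<nu>)"
proof (rule fitsI[of 1 "-1" 0 0 _ \<mu> w])
  fix x y assume "(x, y) \<in> W"
  from x_bounds[OF this] row[OF this]
  show "0 \<le> 1 * x + 0 * y + \<mu> \<and> 0 \<le> 0 * x + (-1) * y + w \<and>
      1 * x + 0 * y + \<mu> + (0 * x + (-1) * y + w) \<le> w + \<mu> + \<nu>" by simp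
qed simp

text \<open>By \<open>x_bounds\<close>, x varies by at most t + \<mu> + \<nu> and y - x by at most w
  - t + \<mu> + \<nu>; neither may be less than \<open>w\<close>.\<close>

lemma width_le: "t \<le> \<mu> + \<nu>" "w - t \<le> \<mu> + \<nu>"
proof -
  show "w - t \<le> \<mu> + \<nu>"
    using width_x[of "- \<mu>"] x_bounds by fastforce
  show "t \<le> \<mu> + \<nu>"
    using width_diff[of "- \<nu>"] x_bounds by fastforce
qed

lemma area_bound_large:
  assumes "w + (\<mu> + \<nu>) < m + n"
  shows "area_bound W"
  by (rule strict[OF fits_strip]) (use assms t floors_nonneg in auto)

lemma deviation_ge: "w * (\<mu> + \<nu>) \<le> m + n"
proof -
  have "w * \<mu> \<le> m" "w * \<nu> \<le> n"
    using t mult_div_mod_eq[of w m] mult_div_mod_eq[of w n] pos_mod_sign[of w m] pos_mod_sign[of w n]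
    unfolding \<mu>_def \<nu>_def by linarith+
  then show ?thesis by (simp add: algebra_simps)
qed

lemma area_bound_width_ge_3:
  assumes "3 \<le> w"
  shows "area_bound W"
proof -
  have "2 \<le> \<mu> + \<nu>" using width_le assms by linarith
  \<comment> \<open>With s = \<mu> + \<nu>, the product (w - 1) (s - 1) exceeds 1 exactly when w + s
    < w s.\<close>
  then have "2 * 1 \<le> (w - 1) * (\<mu> + \<nu> - 1)"
    using assms by (intro mult_mono) auto
  then have "w + (\<mu> + \<nu>) < w * (\<mu> + \<nu>)" by (simp add: algebra_simps)
  then show ?thesis using deviation_ge by (intro area_bound_large) linarith
qed

section \<open>Strips of width 2\<close>

lemma rows_width_2:
  assumes "w = 2" "(x, y) \<in> W"
  shows "y = 0 \<and> 0 \<le> x \<or> y = 1 \<or> y = 2 \<and> t \<le> x" "- n \<le> t * y - 2 * x" "t * y - 2 * x \<le> m"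
proof -
  have "y = 0 \<or> y = 1 \<or> y = 2" using row[OF assms(2)] assms(1) by auto
  then show "y = 0 \<and> 0 \<le> x \<or> y = 1 \<or> y = 2 \<and> t \<le> x"
    using left_bottom[of x] left_top[of x] assms by auto
qed (use dev[OF assms(2)] assms(1) in auto)

text \<open>The polygon fits size 3, so doubled area 4 gives strictness. The few points allowed by
  the deviations either provide it or form a triangle equivalent to
  \<open>wide_triangle\<close>.\<close>

lemma area_bound_width_2_shear_1:
  assumes w: "w = 2" and t1: "t = 1" and "\<mu> + \<nu> = 1" "m + n \<le> 3"
  shows "area_bound W"
proof -
  note R = rows_width_2[OF w, unfolded t1]
  have "w + \<mu> + \<nu> = 3" using assms by linarith
  then have fits: "fits W 3" using fits_strip by simp
  have top': "(1, 2) \<in> W" using top w t1 by simp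
  note area = area_boundI[OF finite fits]
  have "y1 - 2 * x1 = m" using m_point(2) t1 w by simp
  \<comment> \<open>On the rows 0 and 2 the deviation y - 2 x is at most 0 by the choice of leftmost
    points, so a positive maximum lies on the middle row, where the deviation is odd.\<close>
  then have "m = 0 \<or> odd m" using R(1)[OF m_point(1)] m0 by presburger
  moreover have "m div 2 + n div 2 = 1" using assms by (simp add: \<mu>_def \<nu>_def)
  ultimately have "m \<le> 1 \<and> n = 2 \<or> m = 0 \<and> n = 3 \<or> m = 3 \<and> n = 0"
    using assms(4) m0 n0 by presburger
  then consider "m \<le> 1" "n = 2" | "m = 0" "n = 3" | "m = 3" "n = 0" by blast
  then show ?thesis
  proof cases
    case 1
    have R': "(x, y) \<in> {(0, 0), (1, 0), (0, 1), (1, 1), (1, 2), (2, 2)}" if "(x, y) \<in> W" for x y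
      using R[OF that] 1 by auto
    \<comment> \<open>Without (1, 0) only the values 0 and 1 of y - x remain, and without (2, 2)
      only the values 0 and 1 of x; both contradict width 2.\<close>
    have "(1, 0) \<in> W"
    proof (rule ccontr)
      assume "(1, 0) \<notin> W"
      then show False using R' w by (intro width_diff[of 0]) force
    qed
    moreover have "(2, 2) \<in> W"
    proof (rule ccontr)
      assume "(2, 2) \<notin> W"
      then show False using R' w by (intro width_x[of 0]) force
    qed
    ultimately show ?thesis
      using top' bottom
      by (intro area[of "(1, 0)" "(1, 2)" "(0, 0)" "(2, 2)"]) (auto simp: icross_def)
  next
    case 2
    have R': "(x, y) \<in> {(0, 0), (1, 0), (1, 1), (2, 1), (1, 2), (2, 2)}" if "(x, y) \<in> W" for x y
      using R[OF that] 2 by auto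
    have n': "(2, 1) \<in> W"
      using R'[OF n_point(1)] n_point 2 t1 w by auto
    consider "(1, 0) \<in> W" | "(2, 2) \<in> W" | "(1, 0) \<notin> W" "(2, 2) \<notin> W" by blast
    then show ?thesis
    proof cases
      case 1
      then show ?thesis using top' bottom n'
        by (intro area[of "(1, 0)" "(1, 2)" "(0, 0)" "(2, 1)"]) (auto simp: icross_def)
    next
      case 2
      then show ?thesis using top' bottom n'
        by (intro area[of "(0, 0)" "(2, 2)" "(1, 2)" "(2, 1)"]) (auto simp: icross_def)
    next
      case 3
      show ?thesis
        by (rule area_bound_wide_triangle) (use top' bottom n' R' 3 in force)+
    qed
  next
    case 3
    have R': "(x, y) \<in> {(0, 0), (0, 1), (-1, 1), (1, 2)}" if "(x, y) \<in> W" for x y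
      using R[OF that] 3 by auto
    have m': "(-1, 1) \<in> W"
      using R'[OF m_point(1)] m_point 3 t1 w by auto
    \<comment> \<open>The involution (x, y) to (y - x, y) fixes (0, 0) and (1, 2) and sends (-1, 1)
      to (2, 1).\<close>
    let ?g = "\<lambda>(x, y). ((-1) * x + 1 * y + 0, 0 * x + 1 * y + 0 :: int)"
    have "area_bound (?g ` W)"
    proof (rule area_bound_wide_triangle)
      show "{(0, 0), (1, 2), (2, 1)} \<subseteq> ?g ` W"
        using bottom top' m' by (force simp: image_iff)
      show "?g ` W \<subseteq> {(0, 0), (1, 2), (2, 1), (1, 1)}"
        using R' by force
    qed
    then show ?thesis
      using area_bound_unimodular[OF int_unimodularI[of "-1" 1 1 0 0 0] finite] by simp
  qed
qed

text \<open>The general fit has size 4 = m + n, one short of strictness. In each configuration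
  either a corner is missing and size 3 is enough, or the corners present span doubled area at least
  5.\<close>

lemma area_bound_width_2_deviation_4:
  assumes w: "w = 2" and "\<mu> + \<nu> = 2" "m + n = 4"
  shows "area_bound W"
proof -
  note R = rows_width_2[OF w]
  have "w + \<mu> + \<nu> = 4" using assms by linarith
  then have fits: "fits W 4" using fits_strip by simp
  have top': "(t, 2) \<in> W" using top w by simp
  note area = area_boundI[OF finite fits]
  have strict': "area_bound W" if "fits W 3"
    by (rule strict[OF that]) (use assms in auto)
  \<comment> \<open>The halves of \<open>m\<close> and \<open>n\<close>, rounded down, already add
    up to 2, so nothing is lost in rounding.\<close>
  have even: "even m" "even n"
    using assms unfolding \<mu>_def \<nu>_def by presburger+
  have "m = 0" if "t = 1"
  proof -
    have "y1 - 2 * x1 = m" using m_point(2) that w by simp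
    then show ?thesis using R(1)[OF m_point(1)] m0 even that by presburger
  qed
  moreover have "t = 0 \<or> t = 1" using t w by linarith
  ultimately have "t = 1 \<and> m = 0 \<and> n = 4 \<or> t = 0 \<and> m = 0 \<and> n = 4 \<or> t = 0 \<and> m = 2 \<and> n = 2
      \<or> t = 0 \<and> m = 4 \<and> n = 0"
    using assms(3) even m0 n0 by presburger
  then consider "t = 1" "m = 0" "n = 4" | "t = 0" "m = 0" "n = 4" | "t = 0" "m = 2" "n = 2"
    | "t = 0" "m = 4" "n = 0"
    by blast
  then show ?thesis
  proof cases
    case 1
    have R': "(x, y) \<in> {(0, 0), (1, 0), (2, 0), (1, 1), (2, 1), (1, 2), (2, 2), (3, 2)}"
      if "(x, y) \<in> W" for x y
      using R[OF that] 1 by simp presburger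
    have n': "(2, 0) \<in> W \<or> (3, 2) \<in> W"
      using R'[OF n_point(1)] n_point 1 w by auto
    have top': "(1, 2) \<in> W" using top' 1 by simp
    \<comment> \<open>The first three alternatives contain two triangles of total doubled area at
      least 6; in the last two, missing points on the top or the bottom row allow a fit of size
      3.\<close>
    consider "(2, 0) \<in> W" "(2, 2) \<in> W" | "(2, 0) \<in> W" "(3, 2) \<in> W" | "(3, 2) \<in> W" "(1, 0) \<in> W"
      | "(2, 2) \<notin> W" "(3, 2) \<notin> W" | "(1, 0) \<notin> W" "(2, 0) \<notin> W"
      using n' by blast
    then show ?thesis
    proof cases
      case 1
      then show ?thesis using top' bottom
        by (intro area[of "(0, 0)" "(2, 2)" "(1, 2)" "(2, 0)"]) (auto simp: icross_def)
    next
      case 2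
      then show ?thesis using top' bottom
        by (intro area[of "(0, 0)" "(3, 2)" "(1, 2)" "(2, 0)"]) (auto simp: icross_def)
    next
      case 3
      then show ?thesis using top' bottom
        by (intro area[of "(1, 0)" "(1, 2)" "(0, 0)" "(3, 2)"]) (auto simp: icross_def)
    next
      case 4
      then show ?thesis using R'
        by (intro strict' fitsI[of 1 1 0 0 _ 0 0]) force+
    next
      case 5
      then show ?thesis using R'
        by (intro strict' fitsI[of 1 "-1" "-1" 0 _ 1 2]) force+
    qed
  next
    case 2
    have R': "(x, y) \<in> {0, 1, 2} \<times> {0, 1, 2}" if "(x, y) \<in> W" for x y
      using R[OF that] 2 by simp presburger
    consider "(2, 0) \<in> W" "(2, 2) \<in> W" | "(2, 2) \<notin> W" | "(2, 0) \<notin> W" by blast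
    then show ?thesis
    proof cases
      case 1
      then show ?thesis using top' bottom 2
        by (intro area[of "(0, 0)" "(2, 2)" "(0, 2)" "(2, 0)"]) (auto simp: icross_def)
    next
      case 2
      then show ?thesis using R'
        by (intro strict' fitsI[of 1 1 0 0 _ 0 0]) force+
    next
      case 3
      then show ?thesis using R'
        by (intro strict' fitsI[of 1 "-1" 0 0 _ 0 2]) force+
    qed
  next
    case 3
    have R': "(x, y) \<in> {(0, 0), (1, 0), (-1, 1), (0, 1), (1, 1), (0, 2), (1, 2)}" if "(x, y) \<in> W" for x y
      using R[OF that] 3 by auto
    have "x1 = -1 \<and> y1 = 1"
      using R'[OF m_point(1)] m_point(2) 3 w by auto
    then have m': "(-1, 1) \<in> W" using m_point(1) by simp
    consider "(1, 0) \<in> W" "(1, 2) \<in> W" | "(1, 2) \<notin> W" | "(1, 0) \<notin> W" by blast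
    then show ?thesis
    proof cases
      case 1
      then show ?thesis using top' bottom 3 m'
        by (intro area[of "(1, 0)" "(0, 2)" "(-1, 1)" "(1, 2)"]) (auto simp: icross_def)
    next
      case 2
      then show ?thesis using R'
        by (intro strict' fitsI[of 1 1 0 0 _ 1 0]) force+
    next
      case 3
      then show ?thesis using R'
        by (intro strict' fitsI[of 1 "-1" 0 0 _ 1 2]) force+
    qed
  next
    case 4
    have R': "(x, y) \<in> {(0, 0), (-2, 1), (-1, 1), (0, 1), (0, 2)}" if "(x, y) \<in> W" for x y
      using R[OF that] 4 by auto
    then show ?thesis
      by (intro strict' fitsI[of "-1" 1 0 0 _ 0 0]) force+
  qed
qed

lemma area_bound_width_2:
  assumes w: "w = 2"
  shows "area_bound W"
proof -
  have s: "t \<le> \<mu> + \<nu>" "2 - t \<le> \<mu> + \<nu>" "2 * (\<mu> + \<nu>) \<le> m + n"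
    using width_le deviation_ge w by auto
  \<comment> \<open>With s = \<mu> + \<nu>, failure of the last alternative gives 2 s \<le> m + n
    \<le> 2 + s, hence s \<le> 2; and s = 1 is possible only for t = 1.\<close>
  then consider "\<mu> + \<nu> = 1" "t = 1" "m + n \<le> 3" | "\<mu> + \<nu> = 2" "m + n = 4" | "w + (\<mu> + \<nu>) < m + n"
    using t w by (smt (verit))
  then show ?thesis
    by cases (use area_bound_width_2_shear_1 area_bound_width_2_deviation_4 area_bound_large w in blast)+
qed

end

theorem area_bound: "area_bound W"
proof (rule deviations)
  fix m n x y x' y'
  assume *: "0 \<le> m" "0 \<le> n" "(x, y) \<in> W" "t * y - w * x = m" "(x', y') \<in> W" "t * y' - w * x' = - n"
    "\<And>x y. (x, y) \<in> W \<Longrightarrow> - n \<le> t * y - w * x \<and> t * y - w * x \<le> m"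
  consider "w = 1" | "w = 2" | "3 \<le> w" using t by linarith
  then show ?thesis
    by cases (use area_bound_width_1 area_bound_width_2[OF *] area_bound_width_ge_3[OF *] in blast)+
qed

end

section \<open>Reduction of an arbitrary lattice polygon to a narrow strip\<close>

lemma lattice_polygon_lhull:
  assumes "lattice_polygon P"
  obtains W where "finite W" "W \<noteq> {}" "P = lhull W"
proof -
  obtain V where V: "finite V" "V \<noteq> {}" "V \<subseteq> lattice_points" "P = convex hull V"
    using assms unfolding lattice_polygon_def by blast
  have "inj real_point" by (auto simp: inj_def real_point_def prod_eq_iff)
  then have fin: "finite (real_point -` V)" using V(1) by (rule finite_vimageI[rotated])
  have "V \<subseteq> range real_point"
  proof
    fix v assume "v \<in> V"
    with V(3) obtain i j where "v = (of_int i, of_int j)"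
      by (auto simp: lattice_points_def elim!: Ints_cases)
    then show "v \<in> range real_point" by (metis rangeI real_point_Pair)
  qed
  then have eq: "real_point ` (real_point -` V) = V" by (simp add: image_vimage_eq Int_absorb2)
  with V(2) have "real_point -` V \<noteq> {}" by (metis image_empty)
  moreover have "P = lhull (real_point -` V)" unfolding lhull_def eq by (rule V(4))
  ultimately show thesis using that[OF fin] by blast
qed

lemma area2_horizontal:
  assumes "\<And>p. p \<in> W \<Longrightarrow> snd p = c"
  shows "area2 W = 0"
proof -
  have "lhull W \<subseteq> {z. (0, 1) \<bullet> z = real_of_int c}"
    unfolding lhull_def
    by (rule hull_minimal) (use assms in \<open>auto simp: real_point_def convex_hyperplane\<close>)
  moreover have "negligible {z. (0 :: real, 1 :: real) \<bullet> z = real_of_int c}"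
    by (rule negligible_hyperplane) (simp add: zero_prod_def)
  ultimately show ?thesis
    unfolding area2_def by (metis mult_zero_right negligible_imp_measure0 negligible_subset)
qed

text \<open>Among all unimodular images, one of least height is chosen; nonzero area makes that
  height positive. A translation and a horizontal shear, which keep the rows parallel, then
  normalise the two leftmost points.\<close>

lemma ex_narrow_strip:
  assumes fin: "finite W" and ne: "W \<noteq> {}" and area: "area2 W \<noteq> 0"
  shows "\<exists>g t w. int_unimodular g \<and> narrow_strip (g ` W) t w"
proof -
  define Q where "Q n \<longleftrightarrow> (\<exists>g c. int_unimodular g \<and> (\<forall>p\<in>W. c \<le> snd (g p) \<and> snd (g p) \<le> c + int n))" for n
  have id: "int_unimodular (\<lambda>(x, y). (1 * x + 0 * y + 0, 0 * x + 1 * y + 0))"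
    by (rule int_unimodularI) simp
  obtain p :: "int \<times> int" where "\<forall>r\<in>W. snd r \<le> snd p"
    using finite_ex_max[OF fin ne, of snd] by blast
  moreover obtain q :: "int \<times> int" where "\<forall>r\<in>W. - snd r \<le> - snd q"
    using finite_ex_max[OF fin ne, of "\<lambda>r. - snd r"] by blast
  \<comment> \<open>The identity map already gives some admissible height, so the least one
    exists.\<close>
  ultimately have "Q (nat (snd p - snd q))"
    unfolding Q_def
    by (intro exI[of _ "\<lambda>(x, y). (1 * x + 0 * y + 0, 0 * x + 1 * y + 0)"] exI[of _ "snd q"] conjI id)
       (auto simp: int_nat_eq)
  then have QL: "Q (LEAST n. Q n)" by (rule LeastI)
  define w where "w = int (LEAST n. Q n)"
  obtain g c where g: "int_unimodular g" and gw: "\<And>p. p \<in> W \<Longrightarrow> c \<le> snd (g p) \<and> snd (g p) \<le> c + w"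
    using QL unfolding Q_def w_def by blast
  have wpos: "0 < w"
  proof (rule ccontr)
    assume "\<not> 0 < w"
    then have "w = 0" by (simp add: w_def)
    then have "area2 (g ` W) = 0" using gw by (intro area2_horizontal[of _ c]) force
    then show False using area area2_unimodular[OF g fin] by simp
  qed
  have width: "\<exists>p\<in>W. \<not> (d \<le> snd (h p) \<and> snd (h p) < d + w)" if h: "int_unimodular h" for h d
  proof (rule ccontr)
    assume "\<not> ?thesis"
    \<comment> \<open>A block of \<open>w\<close> consecutive rows is a strip of height w - 1, which
      would undercut the least height.\<close>
    moreover have "int (nat (w - 1)) = w - 1" using wpos by simp
    ultimately have "Q (nat (w - 1))"
      unfolding Q_def using h by (intro exI[of _ h] exI[of _ d]) auto
    then have "(LEAST n. Q n) \<le> nat (w - 1)" by (rule Least_le)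
    then show False using wpos unfolding w_def by linarith
  qed
  have leftmost: "\<exists>p\<in>W. snd (g p) = d \<and> (\<forall>q\<in>W. snd (g q) = d \<longrightarrow> fst (g p) \<le> fst (g q))"
    if "r \<in> W" "snd (g r) = d" for r d
  proof -
    have "finite {p \<in> W. snd (g p) = d}" "{p \<in> W. snd (g p) = d} \<noteq> {}"
      using fin that by (simp, blast)
    then have "\<exists>p\<in>{p \<in> W. snd (g p) = d}. \<forall>q\<in>{p \<in> W. snd (g p) = d}. - fst (g q) \<le> - fst (g p)"
      by (rule finite_ex_max)
    then obtain p where p: "p \<in> W" "snd (g p) = d"
      and le: "\<forall>q\<in>{p \<in> W. snd (g p) = d}. - fst (g q) \<le> - fst (g p)"
      by blast
    have "fst (g p) \<le> fst (g q)" if "q \<in> W" "snd (g q) = d" for q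
      using bspec[OF le, of q] that by simp
    with p show ?thesis by blast
  qed
  \<comment> \<open>The rows c + 1 to c + w alone cannot hold all points, so row \<open>c\<close> is
    occupied; dually, the rows c to c + w - 1 force a point in row c + w.\<close>
  have "\<exists>r\<in>W. snd (g r) = c" using width[OF g, of "c + 1"] gw by force
  then obtain p where p: "p \<in> W" "snd (g p) = c" "\<And>q. q \<in> W \<Longrightarrow> snd (g q) = c \<Longrightarrow> fst (g p) \<le> fst (g q)"
    using leftmost by metis
  have "\<exists>r\<in>W. snd (g r) = c + w" using width[OF g, of c] gw by force
  then obtain q where q: "q \<in> W" "snd (g q) = c + w"
      "\<And>r. r \<in> W \<Longrightarrow> snd (g r) = c + w \<Longrightarrow> fst (g q) \<le> fst (g r)"
    using leftmost by metis
  \<comment> \<open>The shear by \<open>s\<close> subtracts \<open>s\<close> per row, hence s w over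
    the whole height, and so reduces the horizontal offset of the top point modulo
    \<open>w\<close>.\<close>
  define s where "s = (fst (g q) - fst (g p)) div w"
  define t where "t = (fst (g q) - fst (g p)) mod w"
  have st: "fst (g q) - fst (g p) - s * w = t"
    by (simp add: s_def t_def minus_div_mult_eq_mod)
  define h where "h = (\<lambda>(x, y). (1 * x + (- s) * y + (s * c - fst (g p)), 0 * x + 1 * y + (- c)))"
  have h: "int_unimodular h" unfolding h_def by (rule int_unimodularI) simp
  have hg: "h (g r) = (fst (g r) - fst (g p) - s * (snd (g r) - c), snd (g r) - c)" for r
    by (cases "g r") (simp add: h_def algebra_simps)
  have "narrow_strip ((h \<circ> g) ` W) t w"
  proof
    show "finite ((h \<circ> g) ` W)" using fin by simp
    show "(0, 0) \<in> (h \<circ> g) ` W" by (rule image_eqI[OF _ p(1)]) (simp add: hg p(2))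
    show "(t, w) \<in> (h \<circ> g) ` W" by (rule image_eqI[OF _ q(1)]) (simp add: hg q(2) st)
    show "0 \<le> t" "t < w" using wpos by (simp_all add: t_def)
    show "0 \<le> y \<and> y \<le> w" if "(x, y) \<in> (h \<circ> g) ` W" for x y
      using that gw by (force simp: hg)
    show "0 \<le> x" if "(x, 0) \<in> (h \<circ> g) ` W" for x
      using that p(3) by (force simp: hg)
    show "t \<le> x" if x: "(x, w) \<in> (h \<circ> g) ` W" for x
    proof -
      obtain r where r: "r \<in> W" "x = fst (g r) - fst (g p) - s * (snd (g r) - c)" "snd (g r) - c = w"
        using x by (auto simp: hg)
      then have "fst (g q) \<le> fst (g r)" by (intro q(3)) auto
      then show ?thesis using r(2,3) st by simp
    qed
    show "\<exists>p\<in>(h \<circ> g) ` W. \<not> (d \<le> snd (f p) \<and> snd (f p) < d + w)" if "int_unimodular f" for f d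
      using width[OF int_unimodular_compose[OF int_unimodular_compose[OF g h] that], of d] by auto
  qed
  then show ?thesis using int_unimodular_compose[OF g h] by blast
qed

theorem mainTheorem4:
  fixes P :: "(real \<times> real) set"
  assumes "lattice_polygon P"
    and "measure lebesgue P \<noteq> 0"
  shows "measure lebesgue P \<ge> ls_Delta P / 2
    \<and> (measure lebesgue P = ls_Delta P / 2 \<longleftrightarrow>
        ((ls_Delta P \<ge> 1 \<and> lattice_equiv P (convex hull {(0, 0), (ls_Delta P, 0), (0, 1)}))
         \<or> (ls_Delta P = 2 \<and> lattice_equiv P (cbox (0, 0) (1, 1)))
         \<or> (ls_Delta P = 3 \<and> lattice_equiv P (convex hull {(0, 0), (1, 2), (2, 1)}))))"
proof -
  obtain W where W: "finite W" "W \<noteq> {}" "P = lhull W"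
    using assms(1) by (rule lattice_polygon_lhull)
  have "area2 W \<noteq> 0" using assms(2) W(3) by (simp add: area2_def)
  then obtain g t w where g: "int_unimodular g" "narrow_strip (g ` W) t w"
    using ex_narrow_strip[OF W(1,2)] by blast
  have "area_bound W"
    by (rule area_bound_unimodular[OF g(1) W(1) narrow_strip.area_bound[OF g(2)]])
  then show ?thesis unfolding W(3) by (rule area_bound_imp[OF W(1)])
qed

end
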